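(* Let $n\ge 1$, let $v_1\ge v_2\ge\dots\ge v_n>0$ and $q_1\ge q_2\ge\dots\ge q_n>0$ be real numbers, and let $V=(v_{i,j})\in\mathbb{R}_{>0}^{n\times n}$ be the valuation matrix defined by $v_{i,j}=v_iq_j$. Then $V$ has the inverse Monge property in the following sense: for all $1\le i<j\le n$, $$v_{i,i}+v_{j,j}\ \ge\ v_{j,i}+v_{i,j}.$$
   Context: Here $v_i$ is the budget of buyer $i$, $q_j$ is the quality measure of item $j$, and $v_{i,j}=v_iq_j$ is the valuation of buyer $i$ for item $j$. The displayed inequality, for all $i<j$, is what is called the inverse Monge property here. *)

theory Defs
  imports Complex_Main
begin

text \<open>
  An \<open>n \<times> n\<close> matrix is a function \<open>nat \<Rightarrow> nat \<Rightarrow> real\<close> (row, then column), of which only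
  the values at indices in \<open>{1..n}\<close> are relevant.
\<close>

definition valuation_matrix :: "(nat \<Rightarrow> real) \<Rightarrow> (nat \<Rightarrow> real) \<Rightarrow> nat \<Rightarrow> nat \<Rightarrow> real" where
  "valuation_matrix v q i j = v i * q j"

text \<open>
  Only the principal \<open>2 \<times> 2\<close> submatrices are compared here; the usual (inverse) Monge
  condition quantifies over independent pairs of rows and of columns.
\<close>

definition inverse_monge :: "nat \<Rightarrow> (nat \<Rightarrow> nat \<Rightarrow> real) \<Rightarrow> bool" where
  "inverse_monge n V \<longleftrightarrow>
     (\<forall>i j. 1 \<le> i \<and> i < j \<and> j \<le> n \<longrightarrow> V i i + V j j \<ge> V j i + V i j)"

lemma valuation_matrix_pos:
  assumes "antimono_on {1..n} v" and "v n > 0" and "antimono_on {1..n} q" and "q n > 0"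
    and "i \<in> {1..n}" and "j \<in> {1..n}"
  shows "valuation_matrix v q i j > 0"
proof -
  have "v i \<ge> v n" "q j \<ge> q n"
    using assms by (auto simp: monotone_on_def)
  then show ?thesis
    using assms by (simp add: valuation_matrix_def)
qed

end

theory Submission
  imports Defs
begin

text \<open>This is the two-term rearrangement inequality: \<open>v\<close> and \<open>q\<close> are
  ordered the same way, so pairing larger with larger and smaller with smaller gives at least the
  crossed pairing. The gap between the two sums factors into two differences of equal sign.\<close>

theorem mainTheorem2:
  fixes n :: nat and v q :: "nat \<Rightarrow> real"
  assumes "n \<ge> 1"
    and "antimono_on {1..n} v" and "v n > 0"
    and "antimono_on {1..n} q" and "q n > 0"
  shows "inverse_monge n (valuation_matrix v q)"
  unfolding inverse_monge_def valuation_matrix_def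
proof (intro allI impI)
  fix i j :: nat
  assume "1 \<le> i \<and> i < j \<and> j \<le> n"
  then have "v j \<le> v i" "q j \<le> q i"
    using assms(2,4) by (auto simp: monotone_on_def)
  \<comment> \<open>Expanded, this product is exactly the diagonal sum minus the off-diagonal
    sum.\<close>
  then have "0 \<le> (v i - v j) * (q i - q j)"
    by simp
  then show "v j * q i + v i * q j \<le> v i * q i + v j * q j"
    by (simp add: algebra_simps)
qed

end
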